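(* Let $H$ be a separable Hilbert space and let $S(\cdot,\cdot)$ be a continuous symmetric bilinear form on $H$, with induced linear map $\mathcal{S}:H\to H^\ast$, $(\mathcal{S}u)(v)=S(u,v)$. Then for any nonzero continuous linear functional $\phi$ on $H$ such that $\phi$ is not a pure limit point, i.e. $\phi\notin\overline{\mathrm{ran}(\mathcal{S})}\setminus\mathrm{ran}(\mathcal{S})$, we have \[ \mathrm{MI}^\phi(S)=\begin{cases}\mathrm{MI}(S)-1 & \text{if there is } u\in H \text{ such that } \mathcal{S}u=\phi \text{ and } \phi(u)\le 0,\\ \mathrm{MI}(S) & \text{otherwise.}\end{cases} \]
   Context: Hilbert spaces are real. $H^\ast$ is the continuous dual of $H$, with the norm making the Riesz isomorphism $H\to H^\ast$ an isometry. $\mathrm{ran}(\mathcal{S})\subset H^\ast$ is the range of $\mathcal{S}$ and $\overline{\mathrm{ran}(\mathcal{S})}$ its norm closure; elements of $\overline{\mathrm{ran}(\mathcal{S})}\setminus\mathrm{ran}(\mathcal{S})$ are called pure limit points. For a vector space $V$, the Morse index $\mathrm{MI}(S,V)\in\{0,1,2,\dots\}\cup\{\infty\}$ is the maximal dimension of a subspace of $V$ on which $S$ is negative definite. $\mathrm{MI}(S)=\mathrm{MI}(S,H)$, and $\mathrm{MI}^\phi(S)=\mathrm{MI}(S,\mathrm{Ker}(\phi))$. Convention: $\infty-1=\infty$. *)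

theory Defs
  imports "HOL-Analysis.Analysis"
begin

text \<open>The library constant \<^const>\<open>dim\<close> is \<open>0\<close> on infinite-dimensional subspaces, hence the
  extended version.\<close>

definition edim :: "'a::real_vector set \<Rightarrow> enat"
  where "edim W = (if \<exists>B. finite B \<and> W \<subseteq> span B then enat (dim W) else \<infinity>)"

definition negative_definite_on :: "('a::real_vector \<Rightarrow> 'a \<Rightarrow> real) \<Rightarrow> 'a set \<Rightarrow> bool"
  where "negative_definite_on S W \<longleftrightarrow> (\<forall>w\<in>W. w \<noteq> 0 \<longrightarrow> S w w < 0)"

text \<open>The supremum in \<^typ>\<open>enat\<close> is attained when it is finite; it is \<open>\<infinity>\<close> exactly when the
  dimensions are unbounded or some such subspace is infinite-dimensional. The family is never
  empty, as it contains \<open>{0}\<close> for every subspace \<open>V\<close>.\<close>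

definition morse_index :: "('a::real_vector \<Rightarrow> 'a \<Rightarrow> real) \<Rightarrow> 'a set \<Rightarrow> enat"
  where "morse_index S V = Sup (edim ` {W. subspace W \<and> W \<subseteq> V \<and> negative_definite_on S W})"

text \<open>\<^const>\<open>Blinfun\<close> is meaningful only on bounded linear maps; see the lemma below.\<close>

definition induced_map :: "('a::real_normed_vector \<Rightarrow> 'a \<Rightarrow> real) \<Rightarrow> 'a \<Rightarrow> ('a \<Rightarrow>\<^sub>L real)"
  where "induced_map S u = Blinfun (\<lambda>v. S u v)"

lemma induced_map_apply:
  assumes "bounded_bilinear S"
  shows "blinfun_apply (induced_map S u) v = S u v"
  unfolding induced_map_def
  by (simp add: bounded_linear_Blinfun_apply bounded_bilinear.bounded_linear_right[OF assms])

definition pure_limit_point :: "('a::real_normed_vector \<Rightarrow> 'a \<Rightarrow> real) \<Rightarrow> ('a \<Rightarrow>\<^sub>L real) \<Rightarrow> bool"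
  where "pure_limit_point S \<phi> \<longleftrightarrow> \<phi> \<in> closure (range (induced_map S)) - range (induced_map S)"

end

theory Submission
  imports Defs
begin

text \<open>Write \<open>K = Ker \<phi>\<close>. Intersecting a negative definite subspace with \<open>K\<close> lowers its dimension by
  at most one, so the question is whether that one dimension is lost. If \<open>S u = \<phi>\<close> with \<open>\<phi> u \<le> 0\<close>,
  every finite-dimensional negative definite subspace of \<open>K\<close> can be enlarged by one dimension: add
  \<open>u\<close> when \<open>\<phi> u < 0\<close>, and otherwise \<open>y + t u\<close> for a suitable \<open>t\<close> and some \<open>y\<close> orthogonal to the
  subspace with respect to \<open>S\<close> with \<open>\<phi> y \<noteq> 0\<close>. In the remaining cases every negative definite
  subspace can be pushed into \<open>K\<close> injectively, by projecting along a vector \<open>u\<close>: either \<open>S u = \<phi>\<close> and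
  \<open>\<phi> u > 0\<close>, or \<open>\<phi>\<close> lies outside the closure of the range of \<open>S\<close>, and then Hilbert space duality
  yields \<open>u\<close> in the kernel of \<open>S\<close> with \<open>\<phi> u \<noteq> 0\<close>.\<close>

section \<open>Morse indices in terms of finite independent sets\<close>

text \<open>Lets Morse indices be compared through the finite numbers below them, so infinite values
  need no case of their own.\<close>

lemma enat_leI:
  assumes "\<And>k. enat k \<le> m \<Longrightarrow> enat k \<le> n"
  shows "m \<le> n"
proof (cases n)
  case (enat j)
  then show ?thesis
    using assms[of "Suc j"] assms by (cases m) auto
qed simp

lemma enat_le_edim_iff:
  "enat k \<le> edim W \<longleftrightarrow> (\<exists>B\<subseteq>W. finite B \<and> independent B \<and> card B = k)"
proof -
  obtain B0 where B0: "B0 \<subseteq> W" "independent B0" "W \<subseteq> span B0" "card B0 = dim W"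
    using basis_exists by blast
  show ?thesis
  proof (cases "\<exists>B. finite B \<and> W \<subseteq> span B")
    case True
    then have "finite B0"
      using B0 independent_span_bound by (meson order_trans)
    have "k \<le> card B0 \<longleftrightarrow> (\<exists>B\<subseteq>W. finite B \<and> independent B \<and> card B = k)"
    proof
      assume "k \<le> card B0"
      then obtain B where "B \<subseteq> B0" "card B = k" "finite B"
        by (rule obtain_subset_with_card_n)
      then show "\<exists>B\<subseteq>W. finite B \<and> independent B \<and> card B = k"
        using B0 independent_mono by blast
    next
      assume "\<exists>B\<subseteq>W. finite B \<and> independent B \<and> card B = k"
      then show "k \<le> card B0"
        using independent_span_bound[OF \<open>finite B0\<close>] B0(3) by blast
    qed
    with True show ?thesis
      by (simp add: edim_def B0(4))
  next
    case False
    then have "infinite B0"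
      using B0(3) by blast
    then obtain B where "B \<subseteq> B0" "card B = k" "finite B"
      using infinite_arbitrarily_large by blast
    then have "\<exists>B\<subseteq>W. finite B \<and> independent B \<and> card B = k"
      using B0 independent_mono by blast
    with False show ?thesis
      by (auto simp: edim_def)
  qed
qed

text \<open>Trades the supremum over possibly infinite-dimensional subspaces for finite independent
  sets, on which all later constructions operate.\<close>

lemma enat_le_morse_index_iff:
  assumes "subspace V"
  shows "enat k \<le> morse_index S V \<longleftrightarrow>
    (\<exists>B\<subseteq>V. finite B \<and> independent B \<and> card B = k \<and> negative_definite_on S (span B))"
    (is "?L \<longleftrightarrow> ?R")
proof
  assume ?L
  show ?R
  proof (cases k)
    case 0
    then show ?thesis
      by (intro exI[of _ "{}"]) (simp add: negative_definite_on_def independent_empty)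
  next
    case (Suc j)
    \<comment> \<open>Writing \<open>k\<close> as \<open>Suc j\<close> gives a strict bound, which
      some member of the family must exceed even if the supremum is not attained.\<close>
    then have "enat j < morse_index S V"
      using \<open>?L\<close> by (simp add: Suc_ile_eq)
    then obtain W where W: "subspace W" "W \<subseteq> V" "negative_definite_on S W" "enat j < edim W"
      unfolding morse_index_def less_Sup_iff by blast
    then obtain B where "B \<subseteq> W" "finite B" "independent B" "card B = k"
      using Suc enat_le_edim_iff[of k W] by (auto simp: Suc_ile_eq)
    moreover have "span B \<subseteq> W"
      using W(1) \<open>B \<subseteq> W\<close> span_minimal by blast
    ultimately show ?thesis
      using W by (intro exI[of _ B]) (auto simp: negative_definite_on_def)
  qed
next
  assume ?R
  then obtain B where B: "B \<subseteq> V" "finite B" "independent B" "card B = k"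
    "negative_definite_on S (span B)"
    by blast
  then have "enat k \<le> edim (span B)"
    using enat_le_edim_iff span_superset by blast
  also have "\<dots> \<le> morse_index S V"
    unfolding morse_index_def using B assms span_minimal[of B V]
    by (intro Sup_upper) auto
  finally show ?L .
qed

section \<open>Minimal norm vectors and duality in Hilbert space\<close>

text \<open>By convexity midpoints stay in \<open>C\<close>, so the parallelogram law makes every
  minimising sequence Cauchy; its limit lies in \<open>C\<close> because \<open>C\<close> is
  closed.\<close>

lemma min_norm_element_exists:
  fixes C :: "'a::{real_inner,complete_space} set"
  assumes "closed C" "convex C" "C \<noteq> {}"
  shows "\<exists>q\<in>C. \<forall>x\<in>C. norm q \<le> norm x"
proof -
  define d where "d = Inf (norm ` C)"
  have bdd: "bdd_below (norm ` C)"
    by (rule bdd_belowI[of _ 0]) auto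
  have d_le: "d \<le> norm x" if "x \<in> C" for x
    unfolding d_def using that bdd by (simp add: cInf_lower)
  have "d \<ge> 0"
    unfolding d_def using assms(3) by (intro cInf_greatest) auto
  have "\<exists>x\<in>C. norm x < d + inverse (real (Suc n))" for n
    using cInf_lessD[of "norm ` C" "d + inverse (real (Suc n))"] assms(3)
    by (auto simp: d_def)
  then obtain c where c: "\<And>n. c n \<in> C" "\<And>n. norm (c n) < d + inverse (real (Suc n))"
    by metis
  have norm_lim: "(\<lambda>n. norm (c n)) \<longlonglongrightarrow> d"
  proof (rule tendsto_sandwich[of "\<lambda>_. d" _ _ "\<lambda>n. d + inverse (real (Suc n))"])
    show "(\<lambda>n. d + inverse (real (Suc n))) \<longlonglongrightarrow> d"
      using tendsto_add[OF tendsto_const LIMSEQ_inverse_real_of_nat, of d] by simp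
    show "\<forall>\<^sub>F n in sequentially. norm (c n) \<le> d + inverse (real (Suc n))"
      using c(2) less_imp_le by (intro always_eventually) blast
  qed (use d_le c(1) in auto)
  have parallelogram: "(norm (x - y))\<^sup>2 \<le> 2 * (norm x)\<^sup>2 + 2 * (norm y)\<^sup>2 - 4 * d\<^sup>2"
    if "x \<in> C" "y \<in> C" for x y
  proof -
    have "(1/2) *\<^sub>R x + (1/2) *\<^sub>R y \<in> C"
      using that assms(2) by (simp add: convexD)
    then have "d \<le> norm ((1/2) *\<^sub>R (x + y))"
      using d_le by (simp add: scaleR_add_right)
    then have "2 * d \<le> norm (x + y)"
      by simp
    then have "(2 * d)\<^sup>2 \<le> (norm (x + y))\<^sup>2"
      using \<open>d \<ge> 0\<close> by (intro power_mono) auto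
    moreover have "(norm (x + y))\<^sup>2 + (norm (x - y))\<^sup>2 = 2 * (norm x)\<^sup>2 + 2 * (norm y)\<^sup>2"
      by (simp add: power2_norm_eq_inner inner_simps inner_commute)
    ultimately show ?thesis
      by (simp add: power_mult_distrib)
  qed
  have "Cauchy c"
  proof (rule metric_CauchyI)
    fix e :: real
    assume "e > 0"
    have "(\<lambda>n. (norm (c n))\<^sup>2) \<longlonglongrightarrow> d\<^sup>2"
      by (intro tendsto_intros norm_lim)
    \<comment> \<open>With margin \<open>e\<^sup>2 / 4\<close> for both vectors, the bound in
      \<open>parallelogram\<close> becomes exactly \<open>e\<^sup>2\<close>.\<close>
    then have "\<forall>\<^sub>F n in sequentially. (norm (c n))\<^sup>2 < d\<^sup>2 + e\<^sup>2 / 4"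
      using \<open>e > 0\<close> by (intro order_tendstoD(2)) auto
    then obtain N where N: "\<And>n. n \<ge> N \<Longrightarrow> (norm (c n))\<^sup>2 < d\<^sup>2 + e\<^sup>2 / 4"
      by (auto simp: eventually_sequentially)
    have "dist (c m) (c n) < e" if "m \<ge> N" "n \<ge> N" for m n
    proof -
      have "(norm (c m - c n))\<^sup>2 < e\<^sup>2"
        using parallelogram[OF c(1)[of m] c(1)[of n]] N[OF that(1)] N[OF that(2)] by linarith
      then show ?thesis
        using \<open>e > 0\<close> by (simp add: dist_norm power2_less_imp_less)
    qed
    then show "\<exists>M. \<forall>m\<ge>M. \<forall>n\<ge>M. dist (c m) (c n) < e"
      by blast
  qed
  then obtain q where q: "c \<longlonglongrightarrow> q"
    using Cauchy_convergent convergent_def by blast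
  have "q \<in> C"
    using assms(1) c(1) q closed_sequentially by blast
  moreover have "norm q = d"
    using tendsto_norm[OF q] norm_lim LIMSEQ_unique by blast
  ultimately show ?thesis
    using d_le by blast
qed

lemma min_norm_orthogonal:
  fixes q d :: "'a::real_inner"
  assumes "\<And>t. norm q \<le> norm (q + t *\<^sub>R d)"
  shows "inner q d = 0"
proof (cases "d = 0")
  case False
  then have pos: "inner d d > 0"
    by simp
  \<comment> \<open>The minimiser of the quadratic polynomial
    \<open>(norm (q + t *\<^sub>R d))\<^sup>2\<close> in \<open>t\<close>.\<close>
  let ?t = "- inner q d / inner d d"
  have "(norm q)\<^sup>2 \<le> (norm (q + ?t *\<^sub>R d))\<^sup>2"
    by (intro power_mono assms) simp
  also have "\<dots> = (norm q)\<^sup>2 - (inner q d)\<^sup>2 / inner d d"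
    using pos unfolding power2_norm_eq_inner
    by (simp add: inner_simps inner_commute[of d q] field_simps power2_eq_square)
  finally have "(inner q d)\<^sup>2 / inner d d \<le> 0"
    by simp
  with pos show ?thesis
    by (auto simp: divide_le_0_iff simp del: inner_gt_zero_iff)
qed simp

text \<open>The shortest vector of the hyperplane where \<open>\<psi>\<close> equals 1 is orthogonal
  to the kernel of \<open>\<psi>\<close>, so a multiple of it represents
  \<open>\<psi>\<close>.\<close>

lemma Riesz_representation:
  fixes \<psi> :: "'a::{real_inner,complete_space} \<Rightarrow>\<^sub>L real"
  shows "\<exists>f. \<forall>v. inner f v = \<psi> v"
proof (cases "\<psi> = 0")
  case True
  then show ?thesis
    by (intro exI[of _ 0]) simp
next
  case False
  then obtain v0 where v0: "\<psi> v0 \<noteq> 0"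
    using blinfun_eqI[of \<psi> 0] by auto
  let ?C = "{v. \<psi> v = 1}"
  have "closed ?C"
    by (intro closed_Collect_eq continuous_intros)
  moreover have "convex ?C"
    by (auto simp: convex_def blinfun.add_right blinfun.scaleR_right)
  moreover have "?C \<noteq> {}"
    using v0 by (auto simp: blinfun.scaleR_right intro!: exI[of _ "(1 / \<psi> v0) *\<^sub>R v0"])
  ultimately have "\<exists>q\<in>?C. \<forall>x\<in>?C. norm q \<le> norm x"
    by (rule min_norm_element_exists)
  then obtain q where q: "\<psi> q = 1" "\<And>x. \<psi> x = 1 \<Longrightarrow> norm q \<le> norm x"
    by auto
  have "inner q (v - \<psi> v *\<^sub>R q) = 0" for v
    by (rule min_norm_orthogonal, rule q(2))
      (simp add: q(1) blinfun.add_right blinfun.diff_right blinfun.scaleR_right)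
  then have eq: "inner q v = \<psi> v * inner q q" for v
    by (metis eq_iff_diff_eq_0 inner_diff_right inner_scaleR_right)
  have "inner q q \<noteq> 0"
    using q(1) by auto
  then have "inner ((1 / inner q q) *\<^sub>R q) v = \<psi> v" for v
    by (simp only: inner_scaleR_left eq[of v]) simp
  then show ?thesis
    by blast
qed

text \<open>Let \<open>f\<close> and \<open>T\<close> represent \<open>\<phi>\<close> and
  \<open>S\<close>. The shortest vector \<open>q\<close> in the closure of \<open>f - ran T\<close>
  is orthogonal to \<open>ran T\<close>, and it is nonzero because \<open>f\<close> is not a limit
  of vectors \<open>T u\<close>.\<close>

lemma kernel_vector_if_not_in_closure_range:
  fixes S :: "'a::{real_inner,complete_space} \<Rightarrow> 'a \<Rightarrow> real"
  assumes S: "bounded_bilinear S"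
    and \<phi>: "\<phi> \<notin> closure (range (induced_map S))"
  obtains q where "\<phi> q \<noteq> 0" "\<And>u. S u q = 0"
proof -
  interpret S: bounded_bilinear S by fact
  obtain f where f: "\<And>v. inner f v = \<phi> v"
    using Riesz_representation by blast
  have "\<forall>u. \<exists>g. \<forall>v. inner g v = S u v"
    using Riesz_representation induced_map_apply[OF S] by metis
  then obtain T where T: "\<And>u v. inner (T u) v = S u v"
    by metis
  have T_lin: "T (a *\<^sub>R u + b *\<^sub>R v) = a *\<^sub>R T u + b *\<^sub>R T v" for a b u v
    by (rule vector_eq_ldot[THEN iffD1])
      (simp add: T inner_simps inner_commute[of _ "T _"] S.add_left S.scaleR_left)
  define D where "D = range (\<lambda>u. f - T u)"
  have "convex D"
    unfolding convex_def
  proof (intro ballI allI impI)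
    fix x y and a b :: real
    assume "x \<in> D" "y \<in> D" and ab: "a + b = 1"
    then obtain u v where "x = f - T u" "y = f - T v"
      by (auto simp: D_def)
    then have "a *\<^sub>R x + b *\<^sub>R y = (a + b) *\<^sub>R f - T (a *\<^sub>R u + b *\<^sub>R v)"
      by (simp only: T_lin scaleR_add_left scaleR_diff_right) simp
    then show "a *\<^sub>R x + b *\<^sub>R y \<in> D"
      using ab by (auto simp: D_def)
  qed
  then obtain q where q: "q \<in> closure D" "\<And>x. x \<in> closure D \<Longrightarrow> norm q \<le> norm x"
    using min_norm_element_exists[of "closure D"] by (auto simp: D_def convex_closure)
  have "S u q = 0" for u
  proof -
    \<comment> \<open>\<open>D\<close> is invariant under translation by \<open>ran T\<close>, and
      so is its closure.\<close>
    have "q + t *\<^sub>R T u \<in> closure D" for t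
    proof -
      have "(+) (t *\<^sub>R T u) ` D \<subseteq> D"
      proof (clarsimp simp: D_def)
        fix v
        have "t *\<^sub>R T u + (f - T v) = f - T (1 *\<^sub>R v + (- t) *\<^sub>R u)"
          by (simp only: T_lin) simp
        then show "t *\<^sub>R T u + (f - T v) \<in> range (\<lambda>u. f - T u)"
          by blast
      qed
      then have "(+) (t *\<^sub>R T u) ` closure D \<subseteq> closure D"
        by (metis closure_mono closure_translation)
      with q(1) show ?thesis
        by (auto simp: add.commute)
    qed
    then have "inner q (T u) = 0"
      by (intro min_norm_orthogonal q(2))
    then show ?thesis
      using T[of u q] by (simp add: inner_commute)
  qed
  moreover have "\<phi> q \<noteq> 0"
  proof
    assume "\<phi> q = 0"
    \<comment> \<open>Both \<open>f\<close> and every \<open>T u\<close> are now orthogonal to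
      \<open>q\<close>; passing to the closure makes \<open>q\<close> orthogonal to itself.\<close>
    have "D \<subseteq> {x. inner x q = 0}"
      using \<open>\<phi> q = 0\<close> \<open>\<And>u. S u q = 0\<close> by (auto simp: D_def inner_diff_left f T)
    moreover have "closed {x. inner x q = 0}"
      by (intro closed_Collect_eq continuous_intros)
    ultimately have "inner q q = 0"
      using q(1) closure_minimal by blast
    then have "0 \<in> closure D"
      using q(1) by simp
    have "\<phi> \<in> closure (range (induced_map S))"
      unfolding closure_approachable
    proof (intro allI impI)
      fix e :: real
      assume "e > 0"
      then obtain u where u: "norm (f - T u) < e"
        using \<open>0 \<in> closure D\<close> by (force simp: closure_approachable D_def dist_norm)
      \<comment> \<open>Cauchy-Schwarz carries the approximation of \<open>f\<close> over to the
        dual norm.\<close>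
      have "norm (\<phi> - induced_map S u) \<le> norm (f - T u)"
      proof (rule norm_blinfun_bound)
        show "norm ((\<phi> - induced_map S u) v) \<le> norm (f - T u) * norm v" for v
          using Cauchy_Schwarz_ineq2[of "f - T u" v]
          by (simp add: blinfun.diff_left induced_map_apply[OF S] f T inner_diff_left)
      qed simp
      with u show "\<exists>y\<in>range (induced_map S). dist y \<phi> < e"
        by (intro bexI[of _ "induced_map S u"]) (auto simp: dist_norm norm_minus_commute)
    qed
    with \<phi> show False
      by blast
  qed
  ultimately show ?thesis
    using that by blast
qed

section \<open>Orthogonality with respect to \<open>S\<close>\<close>

text \<open>Gram-Schmidt for \<open>S\<close>: the part \<open>c\<close> of the new vector
  orthogonal to \<open>span B\<close> satisfies \<open>S c c < 0\<close> unless it vanishes, so one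
  can divide by \<open>S c c\<close>.\<close>

lemma orthogonal_projection_on_negative_definite:
  fixes S :: "'a::real_normed_vector \<Rightarrow> 'a \<Rightarrow> real"
  assumes S: "bounded_bilinear S"
    and "finite B" "negative_definite_on S (span B)"
  shows "\<exists>w\<in>span B. \<forall>x\<in>span B. S (v - w) x = 0"
  using assms(2,3)
proof (induction B arbitrary: v rule: finite_induct)
  case empty
  interpret S: bounded_bilinear S by fact
  show ?case
    by (simp add: S.zero_right)
next
  case (insert b B)
  interpret S: bounded_bilinear S by fact
  have sub: "span B \<subseteq> span (insert b B)"
    by (rule span_mono) auto
  have neg: "negative_definite_on S (span B)"
    using insert.prems sub by (auto simp: negative_definite_on_def)
  obtain wb where wb: "wb \<in> span B" "\<And>x. x \<in> span B \<Longrightarrow> S (b - wb) x = 0"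
    using insert.IH[OF neg, of b] by blast
  obtain wv where wv: "wv \<in> span B" "\<And>x. x \<in> span B \<Longrightarrow> S (v - wv) x = 0"
    using insert.IH[OF neg, of v] by blast
  define c where "c = b - wb"
  have c_in: "c \<in> span (insert b B)"
    unfolding c_def using wb(1) sub by (intro span_diff) (auto simp: span_base)
  define s where "s = S (v - wv) c / S c c"
  let ?w = "wv + s *\<^sub>R c"
  have c_orth: "S (v - ?w) c = 0"
  \<comment> \<open>If \<open>b\<close> already lies in \<open>span B\<close>, then
    \<open>c = 0\<close> and there is nothing to correct.\<close>
  proof (cases "c = 0")
    case False
    then have "S c c < 0"
      using c_in insert.prems by (auto simp: negative_definite_on_def)
    then show ?thesis
      by (simp add: s_def S.diff_left S.add_left S.scaleR_left)
  qed (simp add: S.zero_right)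
  show ?case
  proof (intro bexI ballI)
    show "?w \<in> span (insert b B)"
      using wv(1) sub c_in by (intro span_add span_scale) auto
    fix x
    assume "x \<in> span (insert b B)"
    then obtain k where "x - k *\<^sub>R b \<in> span B"
      by (auto simp: span_insert)
    then have "(x - k *\<^sub>R b) + k *\<^sub>R wb \<in> span B"
      using wb(1) by (intro span_add span_scale)
    then have y: "x - k *\<^sub>R c \<in> span B"
      by (simp add: c_def algebra_simps)
    have "S (v - ?w) (x - k *\<^sub>R c) = 0"
      using wv(2)[OF y] wb(2)[OF y]
      by (simp add: c_def[symmetric] S.diff_left[of "v - wv" "s *\<^sub>R c"] S.scaleR_left
        diff_diff_eq[symmetric])
    then show "S (v - ?w) x = 0"
      using c_orth by (simp add: S.diff_right S.scaleR_right)
  qed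
qed

text \<open>Orthogonality removes the cross terms of \<open>S\<close> on
  \<open>y + k *\<^sub>R z\<close>. It also keeps \<open>z\<close> out of \<open>span B\<close>,
  where \<open>S z z\<close> would be 0.\<close>

lemma negative_definite_extend:
  assumes S: "bounded_bilinear S" and sym: "\<And>u v. S u v = (S v u :: real)"
    and B: "finite B" "independent B" "negative_definite_on S (span B)"
    and z: "S z z < 0" "\<And>x. x \<in> span B \<Longrightarrow> S z x = 0"
  shows "finite (insert z B)" "independent (insert z B)" "card (insert z B) = Suc (card B)"
    "negative_definite_on S (span (insert z B))"
proof -
  interpret S: bounded_bilinear S by fact
  have "z \<notin> span B"
    using z by force
  then have "z \<notin> B"
    using span_base by blast
  show "finite (insert z B)" "card (insert z B) = Suc (card B)"
    using B(1) \<open>z \<notin> B\<close> by auto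
  show "independent (insert z B)"
    using B(2) \<open>z \<notin> span B\<close> by (simp add: independent_insert)
  show "negative_definite_on S (span (insert z B))"
    unfolding negative_definite_on_def
  proof (intro ballI impI)
    fix x
    assume "x \<in> span (insert z B)" "x \<noteq> 0"
    then obtain k where k: "x - k *\<^sub>R z \<in> span B"
      by (auto simp: span_insert)
    define y where "y = x - k *\<^sub>R z"
    have x: "x = y + k *\<^sub>R z"
      by (simp add: y_def)
    have "S z y = 0" "S y z = 0"
      using z(2) k sym[of y z] by (auto simp: y_def)
    then have eq: "S x x = S y y + k\<^sup>2 * S z z"
      by (simp add: x S.add_left S.add_right S.scaleR_left S.scaleR_right power2_eq_square)
    show "S x x < 0"
    proof (cases "y = 0")
      case True
      then have "k \<noteq> 0"
        using \<open>x \<noteq> 0\<close> x by auto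
      then show ?thesis
        using z(1) eq True by (simp add: S.zero_left mult_pos_neg)
    next
      case False
      then have "S y y < 0"
        using B(3) k by (auto simp: negative_definite_on_def y_def)
      moreover have "k\<^sup>2 * S z z \<le> 0"
        using z(1) by (simp add: mult_nonneg_nonpos)
      ultimately show ?thesis
        using eq by linarith
    qed
  qed
qed

section \<open>Comparing the Morse indices of the whole space and of the kernel\<close>

lemma subspace_ker: "subspace {v. blinfun_apply \<phi> v = 0}"
  by (auto simp: subspace_def blinfun.add_right blinfun.scaleR_right blinfun.zero_right)

lemma linear_projection_along: "linear (\<lambda>x. x - (blinfun_apply \<phi> x / c) *\<^sub>R u)"
  by (intro linearI)
    (simp_all add: blinfun.add_right blinfun.scaleR_right algebra_simps add_divide_distrib)

lemma morse_index_ker_le: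
  "morse_index S {v. blinfun_apply \<phi> v = 0} \<le> morse_index S UNIV"
  unfolding morse_index_def by (intro Sup_subset_mono image_mono) auto

text \<open>One basis vector \<open>b\<close> is given up: an arbitrary one if all lie in the
  kernel, otherwise one outside it, along which the others are projected into the kernel.\<close>

lemma enat_le_morse_index_UNIV_imp_ker:
  fixes \<phi> :: "'a::real_normed_vector \<Rightarrow>\<^sub>L real"
  assumes "enat (Suc k) \<le> morse_index S UNIV"
  shows "enat k \<le> morse_index S {v. blinfun_apply \<phi> v = 0}"
proof -
  let ?K = "{v. blinfun_apply \<phi> v = 0}"
  obtain B where B: "finite B" "independent B" "card B = Suc k" "negative_definite_on S (span B)"
    using assms enat_le_morse_index_iff[of UNIV "Suc k" S] by auto
  have "\<exists>B'\<subseteq>?K. finite B' \<and> independent B' \<and> card B' = k \<and> negative_definite_on S (span B')"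
  proof (cases "B \<subseteq> ?K")
    case True
    obtain b where "b \<in> B"
      using B(3) by fastforce
    have "span (B - {b}) \<subseteq> span B"
      by (rule span_mono) auto
    then show ?thesis
      using True B \<open>b \<in> B\<close> independent_mono[of B "B - {b}"]
      by (intro exI[of _ "B - {b}"]) (auto simp: negative_definite_on_def)
  next
    case False
    then obtain b where b: "b \<in> B" "\<phi> b \<noteq> 0"
      by auto
    define A where "A = B - {b}"
    define P where "P x = x - (\<phi> x / \<phi> b) *\<^sub>R b" for x
    have P: "linear P"
      unfolding P_def by (rule linear_projection_along)
    have "b \<notin> span A"
      using B(2) b(1) by (auto simp: dependent_def A_def)
    \<comment> \<open>\<open>P\<close> kills only multiples of \<open>b\<close>, and by independence
      only 0 among them lies in \<open>span A\<close>.\<close>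
    have "inj_on P (span A)"
    proof (subst linear_injective_on_subspace_0[OF P subspace_span], intro ballI impI)
      fix x
      assume x: "x \<in> span A" "P x = 0"
      then have eq: "x = (\<phi> x / \<phi> b) *\<^sub>R b"
        by (simp add: P_def)
      then have "\<phi> x / \<phi> b = 0"
        using x(1) \<open>b \<notin> span A\<close> span_scale[of x A "inverse (\<phi> x / \<phi> b)"]
        by (metis left_inverse scaleR_one scaleR_scaleR)
      with eq show "x = 0"
        by simp
    qed
    moreover have "independent A" "finite A" "card A = k"
      using B b(1) independent_mono[of B A] by (auto simp: A_def)
    ultimately have "independent (P ` A)" "card (P ` A) = k" "finite (P ` A)"
      using linear_independent_injective_image[OF P]
        card_image[OF inj_on_subset[OF _ span_superset]] by auto
    \<comment> \<open>Projecting along a member of \<open>B\<close> does not leave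
      \<open>span B\<close>, so negative definiteness is inherited.\<close>
    moreover have "P ` A \<subseteq> span B"
      using b(1) by (auto simp: P_def A_def span_base span_scale intro!: span_diff)
    then have "span (P ` A) \<subseteq> span B"
      by (simp add: span_minimal)
    then have "negative_definite_on S (span (P ` A))"
      using B(4) by (auto simp: negative_definite_on_def)
    moreover have "P ` A \<subseteq> ?K"
      using b(2) by (auto simp: P_def blinfun.diff_right blinfun.scaleR_right)
    ultimately show ?thesis
      by blast
  qed
  then show ?thesis
    using enat_le_morse_index_iff[OF subspace_ker] by blast
qed

text \<open>The vector \<open>u\<close> is orthogonal to the kernel with respect to
  \<open>S\<close>, and \<open>S u u = \<phi> u\<close>. If this is 0, \<open>u\<close> alone does
  not suffice, but adding multiples of it to a vector outside the kernel makes \<open>S\<close>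
  negative.\<close>

lemma enat_le_morse_index_ker_imp_Suc:
  assumes S: "bounded_bilinear S" and sym: "\<And>u v. S u v = (S v u :: real)"
    and "\<phi> \<noteq> 0" and u: "\<And>v. S u v = blinfun_apply \<phi> v" "\<phi> u \<le> 0"
    and k: "enat k \<le> morse_index S {v. \<phi> v = 0}"
  shows "enat (Suc k) \<le> morse_index S UNIV"
proof -
  interpret S: bounded_bilinear S by fact
  obtain B where B: "B \<subseteq> {v. \<phi> v = 0}" "finite B" "independent B" "card B = k"
    "negative_definite_on S (span B)"
    using k enat_le_morse_index_iff[OF subspace_ker] by blast
  have \<phi>0: "\<phi> x = 0" if "x \<in> span B" for x
    using span_minimal[OF B(1) subspace_ker] that by auto
  obtain z where "S z z < 0" "\<And>x. x \<in> span B \<Longrightarrow> S z x = 0"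
  proof (cases "\<phi> u = 0")
    case False
    then show ?thesis
      using that[of u] u \<phi>0 by auto
  next
    case True
    obtain v where v: "\<phi> v \<noteq> 0"
      using \<open>\<phi> \<noteq> 0\<close> blinfun_eqI[of \<phi> 0] by auto
    obtain w where w: "w \<in> span B" "\<And>x. x \<in> span B \<Longrightarrow> S (v - w) x = 0"
      using orthogonal_projection_on_negative_definite[OF S B(2,5)] by blast
    define y where "y = v - w"
    have y: "\<phi> y \<noteq> 0"
      using v \<phi>0[OF w(1)] by (simp add: y_def blinfun.diff_right)
    \<comment> \<open>As \<open>S u u = 0\<close>, the value of \<open>S\<close> at
      \<open>y + t *\<^sub>R u\<close> is affine in \<open>t\<close> with slope
      \<open>2 * \<phi> y\<close>; this \<open>t\<close> makes it -1.\<close>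
    define t where "t = - (S y y + 1) / (2 * \<phi> y)"
    have "S (y + t *\<^sub>R u) (y + t *\<^sub>R u) = S y y + 2 * t * \<phi> y"
      using u(1) sym[of y u] True
      by (simp add: S.add_left S.add_right S.scaleR_left S.scaleR_right)
    also have "\<dots> = - 1"
      using y by (simp add: t_def field_simps)
    finally have "S (y + t *\<^sub>R u) (y + t *\<^sub>R u) < 0"
      by simp
    moreover have "S (y + t *\<^sub>R u) x = 0" if "x \<in> span B" for x
      using w(2)[OF that] u(1) \<phi>0[OF that] by (simp add: y_def S.add_left S.scaleR_left)
    ultimately show ?thesis
      using that by blast
  qed
  from negative_definite_extend[OF S sym B(2,3,5) this] show ?thesis
    using B(4) enat_le_morse_index_iff[OF subspace_UNIV] by blast
qed

text \<open>Stated for \<open>S u = c \<phi>\<close> so that \<open>c = 1\<close> and \<open>c = 0\<close> cover both remaining cases.\<close>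

lemma morse_index_le_ker:
  assumes S: "bounded_bilinear S" and sym: "\<And>u v. S u v = (S v u :: real)"
    and u: "blinfun_apply \<phi> u \<noteq> 0" "\<And>v. S u v = c * \<phi> v" "0 \<le> c * \<phi> u"
  shows "morse_index S UNIV \<le> morse_index S {v. \<phi> v = 0}"
proof -
  interpret S: bounded_bilinear S by fact
  define P where "P x = x - (\<phi> x / \<phi> u) *\<^sub>R u" for x
  have P: "linear P"
    unfolding P_def by (rule linear_projection_along)
  have P_ker: "\<phi> (P x) = 0" for x
    using u(1) by (simp add: P_def blinfun.diff_right blinfun.scaleR_right)
  \<comment> \<open>\<open>P x\<close> and \<open>u\<close> are orthogonal for \<open>S\<close>, and
    \<open>S u u = c * \<phi> u\<close> is nonnegative, so dropping the \<open>u\<close> component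
    cannot raise the value.\<close>
  have P_le: "S (P x) (P x) \<le> S x x" for x
  proof -
    define a where "a = \<phi> x / \<phi> u"
    have "S (P x) u = 0"
      using sym[of "P x" u] P_ker u(2) by simp
    moreover have "S x x = S (P x + a *\<^sub>R u) (P x + a *\<^sub>R u)"
      by (simp add: P_def a_def)
    ultimately have "S x x = S (P x) (P x) + a\<^sup>2 * S u u"
      using sym[of u "P x"]
      by (simp add: S.add_left S.add_right S.scaleR_left S.scaleR_right power2_eq_square)
    moreover have "0 \<le> a\<^sup>2 * S u u"
      using u by simp
    ultimately show ?thesis
      by linarith
  qed
  show ?thesis
  proof (rule enat_leI)
    fix k
    assume "enat k \<le> morse_index S UNIV"
    then obtain B where B: "finite B" "independent B" "card B = k" "negative_definite_on S (span B)"
      using enat_le_morse_index_iff[of UNIV k S] by auto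
    have neg: "S (P x) (P x) < 0" if "x \<in> span B" "x \<noteq> 0" for x
      using P_le[of x] B(4) that by (force simp: negative_definite_on_def)
    \<comment> \<open>A nonzero \<open>x\<close> with \<open>P x = 0\<close> would give
      \<open>0 < 0\<close> in \<open>neg\<close>.\<close>
    have "inj_on P (span B)"
      by (subst linear_injective_on_subspace_0[OF P subspace_span])
        (use neg in \<open>force simp: S.zero_left\<close>)
    then have "independent (P ` B)" "card (P ` B) = k" "finite (P ` B)"
      using B linear_independent_injective_image[OF P]
        card_image[OF inj_on_subset[OF _ span_superset]] by auto
    moreover have "negative_definite_on S (span (P ` B))"
      unfolding linear_span_image[OF P] negative_definite_on_def
      using neg linear_0[OF P] by force
    ultimately show "enat k \<le> morse_index S {v. \<phi> v = 0}"
      using P_ker enat_le_morse_index_iff[OF subspace_ker, of k S \<phi>] by blast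
  qed
qed

text \<open>Subtraction in \<open>ereal\<close> keeps infinity fixed and does not truncate
  \<open>0 - 1\<close>, so the first case also asserts that the full index is at least 1.\<close>

theorem theorem1p1:
  fixes S :: "'a::{real_inner,complete_space} \<Rightarrow> 'a \<Rightarrow> real"
    and \<phi> :: "'a \<Rightarrow>\<^sub>L real"
  assumes "separable_space (euclidean :: 'a topology)"
    and "bounded_bilinear S"
    and "\<And>u v. S u v = S v u"
    and "\<phi> \<noteq> 0"
    and "\<not> pure_limit_point S \<phi>"
  shows "ereal_of_enat (morse_index S {v. blinfun_apply \<phi> v = 0}) =
    (if \<exists>u. induced_map S u = \<phi> \<and> blinfun_apply \<phi> u \<le> 0
     then ereal_of_enat (morse_index S UNIV) - 1
     else ereal_of_enat (morse_index S UNIV))"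
proof (cases "\<exists>u. induced_map S u = \<phi> \<and> \<phi> u \<le> 0")
  case True
  then obtain u where u: "\<And>v. S u v = \<phi> v" "\<phi> u \<le> 0"
    using induced_map_apply[OF assms(2)] by metis
  note ker_imp_Suc = enat_le_morse_index_ker_imp_Suc[OF assms(2-4) u]
  \<comment> \<open>The successor form treats finite and infinite indices alike; subtraction comes
    only afterwards.\<close>
  have "morse_index S UNIV = eSuc (morse_index S {v. \<phi> v = 0})"
  proof (rule antisym; rule enat_leI)
    fix k
    assume "enat k \<le> morse_index S UNIV"
    then show "enat k \<le> eSuc (morse_index S {v. \<phi> v = 0})"
      using enat_le_morse_index_UNIV_imp_ker by (cases k) (auto simp: eSuc_enat[symmetric] zero_enat_def[symmetric])
  next
    fix k
    assume "enat k \<le> eSuc (morse_index S {v. \<phi> v = 0})"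
    then show "enat k \<le> morse_index S UNIV"
      using ker_imp_Suc by (cases k) (auto simp: eSuc_enat[symmetric] zero_enat_def[symmetric])
  qed
  then have "ereal_of_enat (morse_index S {v. \<phi> v = 0}) = ereal_of_enat (morse_index S UNIV) - 1"
    by (cases "morse_index S {v. \<phi> v = 0}") (simp_all add: eSuc_enat one_ereal_def)
  with True show ?thesis
    by simp
next
  case False
  obtain u c where "\<phi> u \<noteq> 0" "\<And>v. S u v = c * \<phi> v" "0 \<le> c * \<phi> u"
  proof (cases "\<phi> \<in> range (induced_map S)")
    case True
    then obtain u where u: "induced_map S u = \<phi>"
      by auto
    then have "\<phi> u > 0"
      using False by (auto simp: not_le)
    with u show ?thesis
      using that[of u 1] induced_map_apply[OF assms(2), of u] by simp
  next
    case notin: False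
    \<comment> \<open>Here the exclusion of pure limit points enters.\<close>
    then have "\<phi> \<notin> closure (range (induced_map S))"
      using assms(5) by (simp add: pure_limit_point_def)
    from kernel_vector_if_not_in_closure_range[OF assms(2) this]
    obtain q where "\<phi> q \<noteq> 0" "\<And>u. S u q = 0"
      by blast
    then show ?thesis
      using that[of q 0] assms(3)[of q] by simp
  qed
  from morse_index_le_ker[OF assms(2,3) this]
  have "morse_index S {v. \<phi> v = 0} = morse_index S UNIV"
    using morse_index_ker_le antisym by blast
  then show ?thesis
    by (simp only: if_not_P[OF False])
qed

end
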